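(* Let $\Lambda>0$, let the base station (BS) locations form a homogeneous Poisson point process in $\mathbb{R}^2$ of intensity $\Lambda$, and for each integer $k\geq 1$ let $R_k$ be the Euclidean distance from the origin to the $k$-th nearest BS. Then for every integer $k\geq 1$ the random variable $R_k$ has probability density function $$f_{R_k}(r;k)=\frac{2(\Lambda\pi)^k}{(k-1)!}\,r^{2k-1}e^{-\Lambda\pi r^2},\qquad r\geq 0,$$ (and density $0$ for $r<0$).
   Context: A mobile user is located at the origin of the plane. The BSs are the points of a homogeneous Poisson point process $\Phi$ in $\mathbb{R}^2$ with intensity $\Lambda>0$ (the BS density); in particular the probability that exactly $n$ BSs lie within distance $r$ of the origin is $\frac{(\Lambda\pi r^2)^n}{n!}e^{-\Lambda\pi r^2}$. Almost surely the points of $\Phi$ have distinct distances to the origin, and $R_1<R_2<\cdots$ denote these distances listed in increasing order, so that $R_k$ is the distance from the origin to the $k$-th nearest BS. *)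

theory Defs
  imports "HOL-Probability.Probability"
begin

text \<open>
  The process is a random set of points (the homogeneous Poisson process is almost surely simple,
  so no multiplicities are needed). Since every realization is locally finite, the cardinality of
  its intersection with a bounded set is a genuine count. The Poisson law is written out, because
  \<^const>\<open>poisson_pmf\<close> is only meaningful for a positive rate, whereas \<open>B\<close> may be a null set.
\<close>

locale homogeneous_poisson_process = prob_space M
  for M :: "'w measure" and \<Phi> :: "'w \<Rightarrow> 'a::euclidean_space set" and \<Lambda> :: real +
  assumes locally_finite:
      "\<And>\<omega> B. \<omega> \<in> space M \<Longrightarrow> bounded B \<Longrightarrow> finite (\<Phi> \<omega> \<inter> B)"
    and count_measurable:
      "\<And>B. B \<in> sets borel \<Longrightarrow> bounded B \<Longrightarrow>
        random_variable (count_space UNIV) (\<lambda>\<omega>. card (\<Phi> \<omega> \<inter> B))"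
    and count_poisson:
      "\<And>B n. B \<in> sets borel \<Longrightarrow> bounded B \<Longrightarrow>
        prob {\<omega> \<in> space M. card (\<Phi> \<omega> \<inter> B) = n} =
          (\<Lambda> * measure lborel B) ^ n / fact n * exp (- (\<Lambda> * measure lborel B))"
    and count_indep:
      "\<And>(B :: nat \<Rightarrow> 'a set) m. (\<And>i. i < m \<Longrightarrow> B i \<in> sets borel \<and> bounded (B i)) \<Longrightarrow>
        disjoint_family_on B {..<m} \<Longrightarrow>
        indep_vars (\<lambda>_. count_space UNIV) (\<lambda>i \<omega>. card (\<Phi> \<omega> \<inter> B i)) {..<m}"

text \<open>
  The \<open>k\<close>-th term (\<open>k \<ge> 1\<close>) of the strictly increasing listing of the distances from the origin
  to the points of a locally finite set: the distance that has exactly \<open>k - 1\<close> distances below it.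
  It is unspecified if \<open>X\<close> has fewer than \<open>k\<close> distinct distances.
\<close>

definition kth_nearest_dist :: "'a::real_normed_vector set \<Rightarrow> nat \<Rightarrow> real" where
  "kth_nearest_dist X k =
    (THE d. d \<in> dist 0 ` X \<and> card {d' \<in> dist 0 ` X. d' < d} + 1 = k)"

end

theory Submission
  imports Defs
begin

text \<open>
  Almost surely no two points of the process are equidistant from the origin, so \<open>R\<^sub>k \<le> r\<close> holds
  exactly if the closed ball of radius \<open>r\<close> contains at least \<open>k\<close> points. This gives the distribution
  function as a Poisson tail, whose derivative is a telescoping sum. Ties are excluded by cutting a
  ball into \<open>m\<close> shells of equal volume: a tie puts two points into one shell, which
  has probability at most \<open>m (\<mu> / m)\<^sup>2\<close>, where \<open>\<mu>\<close> is the mean number of points in the ball.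
\<close>

section \<open>Ranks in a set of reals with finitely many elements below each bound\<close>

lemma Suc_le_card_atMost_iff:
  fixes S :: "real set"
  assumes fin: "\<And>r. finite {d \<in> S. d \<le> r}"
  shows "Suc k \<le> card {d \<in> S. d \<le> r} \<longleftrightarrow>
    (\<exists>q\<in>\<rat>. k \<le> card {d \<in> S. d \<le> q} \<and> (\<exists>d\<in>S. q < d \<and> d \<le> r))"
proof
  assume *: "Suc k \<le> card {d \<in> S. d \<le> r}"
  define T where "T = {d \<in> S. d \<le> r}"
  have T: "finite T" "Suc k \<le> card T" using fin * by (auto simp: T_def)
  then have "T \<noteq> {}" by auto
  define m where "m = Max T"
  have m: "m \<in> T" "\<And>d. d \<in> T \<Longrightarrow> d \<le> m" using T \<open>T \<noteq> {}\<close> by (auto simp: m_def)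
  \<comment> \<open>\<open>m - 1\<close> stands in when \<open>m\<close> is the only element. In
    either case all of \<open>T\<close> except \<open>m\<close> lies at or below
    \<open>b < m\<close>, so a rational in between cuts off just the largest element.\<close>
  define b where "b = Max (insert (m - 1) (T - {m}))"
  have "b \<in> insert (m - 1) (T - {m})" unfolding b_def by (rule Max_in) (use T in auto)
  then have "b < m" using m(2)[of b] by auto
  then obtain q where q: "q \<in> \<rat>" "b < q" "q < m" using Rats_dense_in_real by blast
  have "d \<le> b" if "d \<in> T - {m}" for d
    unfolding b_def by (rule Max_ge) (use T that in auto)
  then have "T - {m} \<subseteq> {d \<in> S. d \<le> q}" using q by (force simp: T_def)
  then have "card (T - {m}) \<le> card {d \<in> S. d \<le> q}" by (rule card_mono[OF fin])
  moreover have "card (T - {m}) = card T - 1" using m(1) T by simp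
  ultimately have "k \<le> card {d \<in> S. d \<le> q}" using T by linarith
  then show "\<exists>q\<in>\<rat>. k \<le> card {d \<in> S. d \<le> q} \<and> (\<exists>d\<in>S. q < d \<and> d \<le> r)"
    using q m(1) by (auto simp: T_def)
next
  assume "\<exists>q\<in>\<rat>. k \<le> card {d \<in> S. d \<le> q} \<and> (\<exists>d\<in>S. q < d \<and> d \<le> r)"
  then obtain q d where q: "k \<le> card {d \<in> S. d \<le> q}" "d \<in> S" "q < d" "d \<le> r" by blast
  have "card (insert d {d \<in> S. d \<le> q}) \<le> card {d \<in> S. d \<le> r}"
    by (rule card_mono[OF fin]) (use q in auto)
  then show "Suc k \<le> card {d \<in> S. d \<le> r}" using q fin by simp
qed

text \<open>For the converse, take the least \<open>d\<close> in \<open>S\<close> with at least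
  \<open>k\<close> elements up to \<open>d\<close>: by minimality fewer than \<open>k\<close> lie
  strictly below, and \<open>d\<close> itself adds only one, so exactly \<open>k - 1\<close>
  do.\<close>

lemma ex_kth_smallest_iff:
  fixes S :: "real set"
  assumes fin: "\<And>r. finite {d \<in> S. d \<le> r}" and k: "k \<ge> 1"
  shows "(\<exists>d\<le>r. d \<in> S \<and> card {d' \<in> S. d' < d} + 1 = k) \<longleftrightarrow> k \<le> card {d \<in> S. d \<le> r}"
proof
  have fin': "finite {d' \<in> S. d' < d}" for d
    by (rule finite_subset[OF _ fin[of d]]) auto
  {
    assume "\<exists>d\<le>r. d \<in> S \<and> card {d' \<in> S. d' < d} + 1 = k"
    then obtain d where d: "d \<le> r" "d \<in> S" "card {d' \<in> S. d' < d} + 1 = k" by blast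
    have "card (insert d {d' \<in> S. d' < d}) \<le> card {d \<in> S. d \<le> r}"
      by (rule card_mono[OF fin]) (use d in auto)
    then show "k \<le> card {d \<in> S. d \<le> r}" using d fin' by simp
  next
    assume *: "k \<le> card {d \<in> S. d \<le> r}"
    define T where "T = {d \<in> S. d \<le> r \<and> k \<le> card {d' \<in> S. d' \<le> d}}"
    have "finite T" by (rule finite_subset[OF _ fin[of r]]) (auto simp: T_def)
    \<comment> \<open>A nonempty finite initial segment of \<open>S\<close> is cut off by its own
      maximum. This replaces a bound by an element of \<open>S\<close>: for \<open>r\<close> it
      shows that \<open>T\<close> is nonempty, for \<open>d\<close> it yields a smaller element of
      \<open>T\<close>.\<close>
    have attained: "\<exists>e\<in>U. U = {d' \<in> S. d' \<le> e}"
      if "finite U" "U \<noteq> {}" "U \<subseteq> S" "\<And>x y. x \<in> S \<Longrightarrow> y \<in> U \<Longrightarrow> x \<le> y \<Longrightarrow> x \<in> U" for U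
    proof (rule bexI)
      show "Max U \<in> U" using that by simp
      then show "U = {d' \<in> S. d' \<le> Max U}" using that(1,3,4) by (auto intro: Max_ge)
    qed
    have "{d \<in> S. d \<le> r} \<noteq> {}" using * k by force
    then obtain e where "e \<in> S" "e \<le> r" "{d \<in> S. d \<le> r} = {d' \<in> S. d' \<le> e}"
      using attained[of "{d \<in> S. d \<le> r}"] fin by force
    then have "T \<noteq> {}" using * by (auto simp: T_def)
    define d where "d = Min T"
    have dT: "d \<in> T" and dmin: "\<And>e. e \<in> T \<Longrightarrow> d \<le> e"
      using \<open>finite T\<close> \<open>T \<noteq> {}\<close> by (auto simp: d_def)
    have "\<not> k \<le> card {d' \<in> S. d' < d}"
    proof
      assume **: "k \<le> card {d' \<in> S. d' < d}"
      then have "{d' \<in> S. d' < d} \<noteq> {}" using k by force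
      then obtain e where e: "e \<in> S" "e < d" "{d' \<in> S. d' < d} = {d' \<in> S. d' \<le> e}"
        using attained[of "{d' \<in> S. d' < d}"] fin' by force
      then have "e \<in> T" using ** dT by (auto simp: T_def)
      then show False using dmin e(2) by force
    qed
    moreover have "{d' \<in> S. d' \<le> d} = insert d {d' \<in> S. d' < d}" using dT by (auto simp: T_def)
    then have "card {d' \<in> S. d' \<le> d} = card {d' \<in> S. d' < d} + 1" using fin' by simp
    ultimately show "\<exists>d\<le>r. d \<in> S \<and> card {d' \<in> S. d' < d} + 1 = k"
      using dT by (intro exI[of _ d]) (auto simp: T_def)
  }
qed

text \<open>The rank is strictly increasing on \<open>S\<close>, since \<open>x\<close> lies below
  \<open>y\<close> but not below itself. Hence the description in \<open>kth_nearest_dist\<close>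
  picks out at most one distance.\<close>

lemma kth_smallest_unique:
  fixes S :: "real set"
  assumes fin: "\<And>r. finite {d \<in> S. d \<le> r}"
    and "d \<in> S" "e \<in> S" "card {d' \<in> S. d' < d} = card {d' \<in> S. d' < e}"
  shows "d = e"
proof -
  have less: "card {d' \<in> S. d' < x} < card {d' \<in> S. d' < y}" if "x \<in> S" "x < y" for x y
    by (rule psubset_card_mono) (use that in \<open>auto intro: finite_subset[OF _ fin[of y]]\<close>)
  show ?thesis using less[of d e] less[of e d] assms by (cases d e rule: linorder_cases) auto
qed

section \<open>The k-th distance in terms of counts in balls\<close>

lemma dist_image_atMost: "{d \<in> dist 0 ` X. d \<le> r} = dist 0 ` (X \<inter> cball 0 r)"
  by auto

text \<open>With fewer than \<open>k\<close> distinct distances, the defining predicate is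
  constantly false and \<open>THE\<close> returns the same unknown real for every such
  \<open>X\<close>; the second disjunct accounts for it. Natural radii keep that condition
  countable, so the equivalence yields measurability.\<close>

lemma kth_nearest_dist_le_iff:
  assumes fin: "\<And>r. finite (X \<inter> cball 0 r)" and k: "k \<ge> 1"
  shows "kth_nearest_dist X k \<le> a \<longleftrightarrow>
    k \<le> card (dist 0 ` (X \<inter> cball 0 a)) \<or>
    (\<forall>n::nat. \<not> k \<le> card (dist 0 ` (X \<inter> cball 0 (real n)))) \<and> (THE d::real. False) \<le> a"
proof -
  let ?S = "dist 0 ` X"
  let ?P = "\<lambda>d. d \<in> ?S \<and> card {d' \<in> ?S. d' < d} + 1 = k"
  have finS: "finite {d \<in> ?S. d \<le> r}" for r
    unfolding dist_image_atMost using fin by blast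
  have ex: "(\<exists>d\<le>r. ?P d) \<longleftrightarrow> k \<le> card (dist 0 ` (X \<inter> cball 0 r))" for r
    using ex_kth_smallest_iff[OF finS k, of r] unfolding dist_image_atMost .
  show ?thesis
  proof (cases "\<exists>d. ?P d")
    case True
    then obtain d where d: "?P d" by blast
    have uniq: "e = d" if "?P e" for e
      using kth_smallest_unique[OF finS, of e d] that d by linarith
    have "kth_nearest_dist X k = d"
      unfolding kth_nearest_dist_def using d uniq by (rule the_equality)
    moreover have "(\<exists>e\<le>r. ?P e) \<longleftrightarrow> d \<le> r" for r
    proof
      assume "\<exists>e\<le>r. ?P e"
      then obtain e where "e \<le> r" "?P e" by (elim exE conjE) simp
      then show "d \<le> r" using uniq[of e] by simp
    next
      assume "d \<le> r"
      then show "\<exists>e\<le>r. ?P e" using d by (intro exI[of _ d]) simp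
    qed
    \<comment> \<open>At this radius the count reaches \<open>k\<close>, which refutes the second
      disjunct.\<close>
    moreover obtain n :: nat where "d \<le> real n" using real_arch_simple by blast
    ultimately show ?thesis unfolding ex[symmetric] by auto
  next
    case False
    then have "kth_nearest_dist X k = (THE d::real. False)"
      unfolding kth_nearest_dist_def by (intro arg_cong[where f = The]) blast
    moreover have "\<not> k \<le> card (dist 0 ` (X \<inter> cball 0 r))" for r
      unfolding ex[symmetric] using False by blast
    ultimately show ?thesis by simp
  qed
qed

section \<open>Poisson counts, absence of ties, and the law of the k-th distance\<close>

lemma Poisson_weight_tendsto_0: "((\<lambda>x::real. x ^ n / fact n * exp (- x)) \<longlongrightarrow> 0) at_top"
proof -
  have "((\<lambda>x::real. x ^ n / exp x * (1 / fact n)) \<longlongrightarrow> 0 * (1 / fact n)) at_top"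
    by (intro tendsto_intros tendsto_power_div_exp_0)
  then show ?thesis by (simp add: exp_minus field_simps)
qed

context homogeneous_poisson_process
begin

lemma count_cball_finite: "\<omega> \<in> space M \<Longrightarrow> finite (\<Phi> \<omega> \<inter> cball 0 r)"
  by (rule locally_finite) auto

lemma count_sets:
  assumes "B \<in> sets borel" "bounded B"
  shows "{\<omega> \<in> space M. P (card (\<Phi> \<omega> \<inter> B))} \<in> events"
proof -
  have "{\<omega> \<in> space M. P (card (\<Phi> \<omega> \<inter> B))} = (\<lambda>\<omega>. card (\<Phi> \<omega> \<inter> B)) -` Collect P \<inter> space M"
    by blast
  also have "\<dots> \<in> events" by (rule measurable_sets[OF count_measurable[OF assms]]) simp
  finally show ?thesis .
qed

lemma prob_count_ge:
  assumes B: "B \<in> sets borel" "bounded B"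
  defines "\<mu> \<equiv> \<Lambda> * measure lborel B"
  shows "prob {\<omega> \<in> space M. n \<le> card (\<Phi> \<omega> \<inter> B)} = 1 - (\<Sum>j<n. \<mu> ^ j / fact j * exp (- \<mu>))"
proof -
  let ?E = "\<lambda>j. {\<omega> \<in> space M. card (\<Phi> \<omega> \<inter> B) = j}"
  have "{\<omega> \<in> space M. n \<le> card (\<Phi> \<omega> \<inter> B)} = space M - (\<Union>j<n. ?E j)" by auto
  also have "prob \<dots> = 1 - prob (\<Union>j<n. ?E j)"
    by (rule prob_compl) (intro sets.finite_UN count_sets[OF B, where P = "\<lambda>n. n = j" for j] finite_lessThan)
  also have "prob (\<Union>j<n. ?E j) = (\<Sum>j<n. prob (?E j))"
    by (rule finite_measure_finite_Union)
      (use count_sets[OF B] in \<open>auto simp: disjoint_family_on_def\<close>)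
  finally show ?thesis by (simp add: count_poisson[OF B] \<mu>_def)
qed

text \<open>The exact value \<open>1 - (1 + \<mu>) * exp (- \<mu>)\<close> is bounded via
  \<open>exp (- \<mu>) \<ge> 1 - \<mu>\<close>. A bound quadratic in the mean survives summation
  over many small shells.\<close>

lemma prob_two_points_le:
  assumes B: "B \<in> sets borel" "bounded B" and "\<Lambda> \<ge> 0"
  shows "prob {\<omega> \<in> space M. 2 \<le> card (\<Phi> \<omega> \<inter> B)} \<le> (\<Lambda> * measure lborel B)\<^sup>2"
proof -
  define \<mu> where "\<mu> = \<Lambda> * measure lborel B"
  have "\<mu> \<ge> 0" using assms by (simp add: \<mu>_def)
  have "prob {\<omega> \<in> space M. 2 \<le> card (\<Phi> \<omega> \<inter> B)} = 1 - (1 + \<mu>) * exp (- \<mu>)"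
    unfolding prob_count_ge[OF B] \<mu>_def[symmetric] by (simp add: numeral_2_eq_2 algebra_simps)
  also have "(1 + \<mu>) * (1 + - \<mu>) \<le> (1 + \<mu>) * exp (- \<mu>)"
    by (rule mult_left_mono[OF exp_ge_add_one_self]) (use \<open>\<mu> \<ge> 0\<close> in simp)
  then have "1 - (1 + \<mu>) * exp (- \<mu>) \<le> \<mu>\<^sup>2" by (simp add: algebra_simps power2_eq_square)
  finally show ?thesis unfolding \<mu>_def .
qed

lemma AE_inj_on_dist_cball:
  assumes "\<Lambda> \<ge> 0" "R \<ge> 0"
  shows "AE \<omega> in M. inj_on (dist 0) (\<Phi> \<omega> \<inter> cball 0 R)"
proof -
  let ?D = "DIM('a)"
  define \<mu> where "\<mu> = \<Lambda> * (unit_ball_vol ?D * R ^ ?D)"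
  \<comment> \<open>The root makes the volume of the \<open>i\<close>-th ball proportional to
    \<open>i\<close>, so all \<open>m\<close> shells have mean \<open>\<mu> / m\<close>. The radii
    run from \<open>s m 0 = 0\<close> to \<open>s m m = R\<close>.\<close>
  define s where "s m i = R * root ?D (real i / real m)" for m i :: nat
  define A where "A m i = cball (0::'a) (s m (Suc i)) - cball 0 (s m i)" for m i
  define F where "F m = (\<Union>i<m. {\<omega> \<in> space M. 2 \<le> card (\<Phi> \<omega> \<inter> A m i)})" for m
  have A_sets: "A m i \<in> sets borel" "bounded (A m i)" for m i
    by (auto simp: A_def intro: bounded_subset[OF bounded_cball])
  have F_sets: "F m \<in> events" for m
    unfolding F_def by (intro sets.finite_UN) (auto intro: count_sets A_sets)
  have A_vol: "\<Lambda> * measure lborel (A m i) = \<mu> / m" if "m > 0" for m i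
  proof -
    have s_pos: "s m i \<ge> 0" for i using assms by (simp add: s_def)
    have s_pow: "s m i ^ ?D = R ^ ?D * (i / m)" for i
      by (simp add: s_def power_mult_distrib)
    have "s m i \<le> s m (Suc i)"
      unfolding s_def using assms that by (intro mult_left_mono) (auto simp: divide_right_mono)
    then have "measure lborel (A m i) =
        measure lborel (cball (0::'a) (s m (Suc i))) - measure lborel (cball (0::'a) (s m i))"
      unfolding A_def by (intro measure_Diff) (use emeasure_lborel_cball_finite[of 0] in \<open>auto simp: less_top\<close>)
    also have "\<dots> = unit_ball_vol ?D * R ^ ?D * (Suc i / m - i / m)"
      by (simp add: content_cball s_pos s_pow right_diff_distrib)
    also have "Suc i / m - i / m = 1 / (m::real)"
      using that by (simp add: field_simps)
    finally show ?thesis by (simp add: \<mu>_def)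
  qed
  have F_le: "prob (F m) \<le> \<mu>\<^sup>2 / m" if "m > 0" for m
  proof -
    have "prob (F m) \<le> (\<Sum>i<m. prob {\<omega> \<in> space M. 2 \<le> card (\<Phi> \<omega> \<inter> A m i)})"
      unfolding F_def by (rule finite_measure_subadditive_finite) (auto intro: count_sets A_sets)
    also have "\<dots> \<le> (\<Sum>i<m. (\<mu> / m)\<^sup>2)"
      by (intro sum_mono) (use prob_two_points_le[OF A_sets \<open>\<Lambda> \<ge> 0\<close>] A_vol that in metis)
    also have "\<dots> = \<mu>\<^sup>2 / m" using that by (simp add: power2_eq_square field_simps)
    finally show ?thesis .
  qed
  \<comment> \<open>The intersection lies in every \<open>F (Suc m)\<close>, hence is null. The set
    of outcomes with ties need not be an event; it only has to lie inside this null set.\<close>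
  have "prob (\<Inter>m. F (Suc m)) \<le> \<mu>\<^sup>2 / Suc m" for m
    by (rule order_trans[OF finite_measure_mono F_le]) (use F_sets in auto)
  moreover have "(\<lambda>m. \<mu>\<^sup>2 / Suc m) \<longlonglongrightarrow> 0"
    using LIMSEQ_Suc[OF lim_const_over_n[of "\<mu>\<^sup>2"]] by simp
  ultimately have "prob (\<Inter>m. F (Suc m)) \<le> 0"
    by (intro tendsto_lowerbound[of _ _ sequentially]) auto
  then have "(\<Inter>m. F (Suc m)) \<in> null_sets M"
    using F_sets by (auto simp: null_sets_def emeasure_eq_measure measure_le_0_iff)
  moreover have "{\<omega> \<in> space M. \<not> inj_on (dist 0) (\<Phi> \<omega> \<inter> cball 0 R)} \<subseteq> (\<Inter>m. F (Suc m))"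
  proof (intro subsetI INT_I)
    fix \<omega> and l :: nat
    define m where "m = Suc l"
    assume "\<omega> \<in> {\<omega> \<in> space M. \<not> inj_on (dist 0) (\<Phi> \<omega> \<inter> cball 0 R)}"
    then obtain x y where \<omega>: "\<omega> \<in> space M" and xy: "x \<in> \<Phi> \<omega>" "y \<in> \<Phi> \<omega>" "x \<noteq> y"
        "norm x = norm y" "norm x \<le> R"
      by (auto simp: inj_on_def)
    \<comment> \<open>The shells omit the origin, but two distinct points of equal norm are both
      nonzero.\<close>
    have "\<not> norm x \<le> s m 0" using xy by (auto simp: s_def)
    moreover have "norm x \<le> s m m" using xy by (simp add: s_def m_def)
    ultimately obtain i where i: "i < m" "\<not> norm x \<le> s m i" "norm x \<le> s m (Suc i)"
      using ex_least_nat_less[of "\<lambda>i. norm x \<le> s m i" m] by auto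
    have "{x, y} \<subseteq> \<Phi> \<omega> \<inter> A m i" using xy i by (auto simp: A_def)
    then have "card {x, y} \<le> card (\<Phi> \<omega> \<inter> A m i)"
      by (rule card_mono[OF locally_finite[OF \<omega> A_sets(2)]])
    then have "2 \<le> card (\<Phi> \<omega> \<inter> A m i)" using xy by simp
    then have "\<omega> \<in> F m" using \<omega> i unfolding F_def by blast
    then show "\<omega> \<in> F (Suc l)" by (simp add: m_def)
  qed
  ultimately show ?thesis by (rule AE_I')
qed

text \<open>
  The rationals turn the event into a countable union, so measurability needs no almost sure
  argument; this matters because \<open>M\<close> need not be complete.
\<close>

lemma sets_card_dist_ge: "{\<omega> \<in> space M. k \<le> card (dist 0 ` (\<Phi> \<omega> \<inter> cball 0 r))} \<in> events"
proof (induction k arbitrary: r)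
  case 0
  show ?case by simp
next
  case (Suc k)
  \<comment> \<open>Distinct distances are not a point count, so the largest one is split off:
    occupancy of the shell between \<open>q\<close> and \<open>r\<close> is a count event, and the
    rest is the induction hypothesis at radius \<open>q\<close>.\<close>
  have "Suc k \<le> card (dist 0 ` (\<Phi> \<omega> \<inter> cball 0 r)) \<longleftrightarrow>
      (\<exists>q\<in>\<rat>. k \<le> card (dist 0 ` (\<Phi> \<omega> \<inter> cball 0 q)) \<and> card (\<Phi> \<omega> \<inter> (cball 0 r - cball 0 q)) \<noteq> 0)"
    if \<omega>: "\<omega> \<in> space M" for \<omega>
  proof -
    have "finite {d \<in> dist 0 ` \<Phi> \<omega>. d \<le> r}" for r
      unfolding dist_image_atMost using count_cball_finite[OF \<omega>] by blast
    note iff = Suc_le_card_atMost_iff[OF this, unfolded dist_image_atMost]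
    \<comment> \<open>Finiteness ensures that a nonzero cardinality means a nonempty shell, as
      infinite sets have cardinality 0.\<close>
    have "finite (\<Phi> \<omega> \<inter> (cball 0 r - cball 0 q))" for q
      by (rule finite_subset[OF _ count_cball_finite[OF \<omega>, of r]]) auto
    then have "card (\<Phi> \<omega> \<inter> (cball 0 r - cball 0 q)) \<noteq> 0 \<longleftrightarrow>
        (\<exists>d\<in>dist 0 ` \<Phi> \<omega>. q < d \<and> d \<le> r)" for q
      by (auto simp: not_le)
    then show ?thesis unfolding iff by simp
  qed
  then have "{\<omega> \<in> space M. Suc k \<le> card (dist 0 ` (\<Phi> \<omega> \<inter> cball 0 r))} =
      (\<Union>q\<in>\<rat>. {\<omega> \<in> space M. k \<le> card (dist 0 ` (\<Phi> \<omega> \<inter> cball 0 q))} \<inter>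
        {\<omega> \<in> space M. card (\<Phi> \<omega> \<inter> (cball 0 r - cball 0 q)) \<noteq> 0})"
    by auto
  also have "\<dots> \<in> events"
    by (intro sets.countable_UN'' countable_rat sets.Int Suc.IH
        count_sets[where P = "\<lambda>n. n \<noteq> 0"])
      (auto intro: bounded_subset[OF bounded_cball])
  finally show ?case .
qed

lemma measurable_kth_nearest_dist:
  assumes "k \<ge> 1"
  shows "random_variable borel (\<lambda>\<omega>. kth_nearest_dist (\<Phi> \<omega>) k)"
proof (rule borel_measurableI_le)
  fix a :: real
  let ?E = "\<lambda>r. {\<omega> \<in> space M. k \<le> card (dist 0 ` (\<Phi> \<omega> \<inter> cball 0 r))}"
  have "{\<omega> \<in> space M. kth_nearest_dist (\<Phi> \<omega>) k \<le> a} =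
      ?E a \<union> (if (THE d::real. False) \<le> a then space M - (\<Union>n. ?E (real n)) else {})"
    using kth_nearest_dist_le_iff[OF count_cball_finite assms] by auto
  also have "\<dots> \<in> events" using sets_card_dist_ge by auto
  finally show "{\<omega> \<in> space M. kth_nearest_dist (\<Phi> \<omega>) k \<le> a} \<in> events" .
qed

text \<open>Makes the default value of \<open>THE\<close> a null event. As the ball grows its mean
  count diverges, so each of the \<open>k\<close> Poisson weights below \<open>k\<close> tends to
  0.\<close>

lemma AE_ex_count_ge:
  assumes "\<Lambda> > 0"
  shows "AE \<omega> in M. \<exists>n::nat. k \<le> card (\<Phi> \<omega> \<inter> cball 0 (real n))"
proof -
  let ?E = "\<lambda>n. {\<omega> \<in> space M. k \<le> card (\<Phi> \<omega> \<inter> cball 0 (real n))}"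
  let ?\<mu> = "\<lambda>n. \<Lambda> * measure lborel (cball (0::'a) (real n))"
  have E_sets: "?E n \<in> events" for n by (rule count_sets) auto
  have "filterlim (\<lambda>n. (\<Lambda> * unit_ball_vol DIM('a)) * real n ^ DIM('a)) at_top sequentially"
    by (rule filterlim_tendsto_pos_mult_at_top[OF tendsto_const])
      (auto simp: assms intro!: filterlim_pow_at_top filterlim_real_sequentially)
  then have "filterlim ?\<mu> at_top sequentially"
    by (simp add: content_cball mult.assoc)
  then have "(\<lambda>n. 1 - (\<Sum>j<k. ?\<mu> n ^ j / fact j * exp (- ?\<mu> n))) \<longlonglongrightarrow> 1 - (\<Sum>j<k. 0)"
    by (intro tendsto_diff tendsto_const tendsto_sum filterlim_compose[OF Poisson_weight_tendsto_0])
  then have "(\<lambda>n. prob (?E n)) \<longlonglongrightarrow> 1"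
    by (simp add: prob_count_ge)
  moreover have "prob (?E n) \<le> prob (\<Union>n. ?E n)" for n
    by (rule finite_measure_mono) (use E_sets in auto)
  ultimately have "1 \<le> prob (\<Union>n. ?E n)"
    by (intro tendsto_upperbound[of _ _ sequentially]) auto
  then have "prob (\<Union>n. ?E n) = 1" using prob_le_1 by (rule antisym[rotated])
  then have "AE \<omega> in M. \<omega> \<in> (\<Union>n. ?E n)"
    by (rule AE_prob_1)
  then show ?thesis by (rule AE_mp) auto
qed

lemma prob_kth_nearest_dist_le:
  assumes \<Lambda>: "\<Lambda> > 0" and k: "k \<ge> 1"
  shows "prob {\<omega> \<in> space M. kth_nearest_dist (\<Phi> \<omega>) k \<le> a} =
    prob {\<omega> \<in> space M. k \<le> card (\<Phi> \<omega> \<inter> cball 0 a)}"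
proof (rule finite_measure_eq_AE)
  \<comment> \<open>Almost sure statements combine over countably many radii; every ball lies in one
    of integer radius, and injectivity passes to subsets.\<close>
  have "AE \<omega> in M. \<forall>n::nat. inj_on (dist 0) (\<Phi> \<omega> \<inter> cball 0 (real n))"
    using AE_inj_on_dist_cball \<Lambda> by (simp add: AE_all_countable)
  then show "AE \<omega> in M. \<omega> \<in> {\<omega> \<in> space M. kth_nearest_dist (\<Phi> \<omega>) k \<le> a} \<longleftrightarrow>
      \<omega> \<in> {\<omega> \<in> space M. k \<le> card (\<Phi> \<omega> \<inter> cball 0 a)}"
    using AE_ex_count_ge[OF \<Lambda>, of k]
  proof eventually_elim
    case (elim \<omega>)
    have card_eq: "card (dist 0 ` (\<Phi> \<omega> \<inter> cball 0 r)) = card (\<Phi> \<omega> \<inter> cball 0 r)" for r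
    proof -
      obtain n :: nat where "r \<le> real n" using real_arch_simple by blast
      then have "\<Phi> \<omega> \<inter> cball 0 r \<subseteq> \<Phi> \<omega> \<inter> cball 0 (real n)" by auto
      then show ?thesis using elim(1) by (metis card_image inj_on_subset)
    qed
    show ?case
      using kth_nearest_dist_le_iff[OF count_cball_finite k, of \<omega> a] elim(2)
      unfolding card_eq by auto
  qed
  show "{\<omega> \<in> space M. kth_nearest_dist (\<Phi> \<omega>) k \<le> a} \<in> events"
    using measurable_kth_nearest_dist[OF k] by simp
  show "{\<omega> \<in> space M. k \<le> card (\<Phi> \<omega> \<inter> cball 0 a)} \<in> events"
    by (rule count_sets) auto
qed

end

text \<open>For \<open>j \<ge> 1\<close> the weight with index \<open>j\<close> has derivative
  \<open>2 * c * x\<close> times the difference of the weights with indices \<open>j - 1\<close> and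
  \<open>j\<close>. Only the last weight survives; \<open>n\<close> plays the role of
  \<open>k - 1\<close>.\<close>

lemma Poisson_tail_deriv:
  fixes c x :: real
  shows "((\<lambda>x. 1 - (\<Sum>j<Suc n. (c * x\<^sup>2) ^ j / fact j * exp (- (c * x\<^sup>2)))) has_real_derivative
    2 * c ^ Suc n / fact n * x ^ (2 * n + 1) * exp (- (c * x\<^sup>2))) (at x)"
proof (induction n)
  case 0
  show ?case by (auto intro!: derivative_eq_intros)
next
  case (Suc n)
  let ?t = "\<lambda>x. (c * x\<^sup>2) ^ Suc n / fact (Suc n) * exp (- (c * x\<^sup>2))"
  have "(?t has_real_derivative
      (real (Suc n) * (c * x\<^sup>2) ^ n * (2 * c * x) / fact (Suc n) * exp (- (c * x\<^sup>2))
        - (c * x\<^sup>2) ^ Suc n / fact (Suc n) * exp (- (c * x\<^sup>2)) * (2 * c * x))) (at x)"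
    by (auto intro!: derivative_eq_intros simp: diff_divide_distrib mult_ac
        simp del: power_Suc fact_Suc)
  from DERIV_diff[OF Suc.IH this]
  have "((\<lambda>x. 1 - (\<Sum>j<Suc (Suc n). (c * x\<^sup>2) ^ j / fact j * exp (- (c * x\<^sup>2)))) has_real_derivative
      2 * c ^ Suc n / fact n * x ^ (2 * n + 1) * exp (- (c * x\<^sup>2)) -
      (real (Suc n) * (c * x\<^sup>2) ^ n * (2 * c * x) / fact (Suc n) * exp (- (c * x\<^sup>2))
        - (c * x\<^sup>2) ^ Suc n / fact (Suc n) * exp (- (c * x\<^sup>2)) * (2 * c * x))) (at x)"
    by (simp add: diff_diff_eq)
  \<comment> \<open>The derivative accumulated so far equals the positive half of that of the new
    weight, so subtraction leaves the other half.\<close>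
  also have "2 * c ^ Suc n / fact n * x ^ (2 * n + 1) * exp (- (c * x\<^sup>2)) =
      real (Suc n) * (c * x\<^sup>2) ^ n * (2 * c * x) / fact (Suc n) * exp (- (c * x\<^sup>2))"
    by (simp add: power_mult_distrib power_mult[symmetric] del: of_nat_Suc)
  also have "\<dots> - (\<dots> - (c * x\<^sup>2) ^ Suc n / fact (Suc n) * exp (- (c * x\<^sup>2)) * (2 * c * x)) =
      (c * x\<^sup>2) ^ Suc n / fact (Suc n) * exp (- (c * x\<^sup>2)) * (2 * c * x)"
    by (rule diff_diff_eq2[THEN trans]) (simp only: add_diff_cancel_left')
  also have "(c * x\<^sup>2) ^ Suc n = c ^ Suc n * x ^ (2 * Suc n)"
    by (simp only: power_mult_distrib power_mult)
  also have "c ^ Suc n * x ^ (2 * Suc n) / fact (Suc n) * exp (- (c * x\<^sup>2)) * (2 * c * x) =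
      2 * c ^ Suc (Suc n) / fact (Suc n) * x ^ (2 * Suc n + 1) * exp (- (c * x\<^sup>2))"
    by (simp add: mult_ac del: fact_Suc)
  finally show ?case .
qed

section \<open>The density in the plane\<close>

theorem theorem1:
  fixes M :: "'w measure" and \<Phi> :: "'w \<Rightarrow> (real^2) set" and \<Lambda> :: real and k :: nat
  assumes "\<Lambda> > 0"
    and "homogeneous_poisson_process M \<Phi> \<Lambda>"
    and "k \<ge> 1"
  shows "distributed M lborel (\<lambda>\<omega>. kth_nearest_dist (\<Phi> \<omega>) k)
    (\<lambda>r. ennreal (if r \<ge> 0
       then 2 * (\<Lambda> * pi) ^ k / fact (k - 1) * r ^ (2 * k - 1) * exp (- \<Lambda> * pi * r\<^sup>2)
       else 0))"
proof -
  interpret homogeneous_poisson_process M \<Phi> \<Lambda> by fact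
  define c where "c = \<Lambda> * pi"
  define h where "h r = 2 * c ^ k / fact (k - 1) * r ^ (2 * k - 1) * exp (- (c * r\<^sup>2))" for r
  \<comment> \<open>A disc of radius \<open>r\<close> has mean count \<open>c * r\<^sup>2\<close>,
    so \<open>G\<close> is the distribution function on the nonnegative reals.\<close>
  define G where "G r = 1 - (\<Sum>j<k. (c * r\<^sup>2) ^ j / fact j * exp (- (c * r\<^sup>2)))" for r
  have c: "c > 0" using assms by (simp add: c_def)
  obtain n where n: "k = Suc n" using assms(3) by (cases k) auto
  have G_deriv: "(G has_real_derivative h r) (at r)" for r
    using Poisson_tail_deriv[of c n r] unfolding G_def h_def n by simp
  have h_pos: "h r \<ge> 0" if "r \<ge> 0" for r using that c by (simp add: h_def)
  \<comment> \<open>No mass sits at 0, so integrating \<open>h\<close> from 0 to \<open>a\<close>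
    gives \<open>G a\<close> itself. At mean 0 the weight with index 0 is 1 and the others
    vanish.\<close>
  have G_0: "G 0 = 0" by (simp add: G_def n sum.lessThan_Suc_shift del: sum.lessThan_Suc)
  have [measurable]: "h \<in> borel_measurable borel" unfolding h_def by measurable
  have "distributed M lborel (\<lambda>\<omega>. kth_nearest_dist (\<Phi> \<omega>) k)
      (\<lambda>r. ennreal (if r \<ge> 0 then h r else 0))"
  proof (rule distributedI_borel_atMost[where g = "\<lambda>a. if a \<ge> 0 then G a else 0"])
    show "random_variable borel (\<lambda>\<omega>. kth_nearest_dist (\<Phi> \<omega>) k)"
      by (rule measurable_kth_nearest_dist) fact
    show "(\<lambda>r. if r \<ge> 0 then h r else 0) \<in> borel_measurable borel" by measurable
    show "AE r in lborel. 0 \<le> (if r \<ge> 0 then h r else 0)" using h_pos by auto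
    show "(\<integral>\<^sup>+ r. ennreal ((if r \<ge> 0 then h r else 0) * indicator {..a} r) \<partial>lborel) =
        ennreal (if a \<ge> 0 then G a else 0)" for a
    proof (cases "a \<ge> 0")
      case True
      have "(\<integral>\<^sup>+ r. ennreal ((if r \<ge> 0 then h r else 0) * indicator {..a} r) \<partial>lborel) =
          (\<integral>\<^sup>+ r. ennreal (h r) * indicator {0..a} r \<partial>lborel)"
        by (intro nn_integral_cong) (auto simp: indicator_def)
      also have "\<dots> = ennreal (G a - G 0)"
        by (rule nn_integral_FTC_Icc) (use True h_pos G_deriv in \<open>auto intro: DERIV_subset\<close>)
      finally show ?thesis using True G_0 by simp
    next
      case False
      then have "(\<integral>\<^sup>+ r. ennreal ((if r \<ge> 0 then h r else 0) * indicator {..a} r) \<partial>lborel) =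
          (\<integral>\<^sup>+ (r::real). 0 \<partial>lborel)"
        by (intro nn_integral_cong) (auto simp: indicator_def)
      then show ?thesis using False by simp
    qed
    show "emeasure M {\<omega> \<in> space M. kth_nearest_dist (\<Phi> \<omega>) k \<le> a} =
        ennreal (if a \<ge> 0 then G a else 0)" for a
    proof (cases "a \<ge> 0")
      case True
      then have "\<Lambda> * measure lborel (cball (0::real^2) a) = c * a\<^sup>2"
        by (simp add: content_cball unit_ball_vol_2 c_def)
      then show ?thesis
        using True prob_count_ge[of "cball 0 a" k]
        by (simp add: emeasure_eq_measure prob_kth_nearest_dist_le[OF assms(1,3)] G_def)
    next
      \<comment> \<open>For negative \<open>a\<close> the ball is empty, so it cannot contain
        \<open>k \<ge> 1\<close> points.\<close>
      case False
      then show ?thesis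
        using assms(3) by (simp add: emeasure_eq_measure prob_kth_nearest_dist_le[OF assms(1,3)])
    qed
  qed
  then show ?thesis by (simp only: h_def c_def mult_minus_left)
qed

end
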